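(* Let $f\in\mathcal{S}^*$ have Taylor expansion $f(z)=z+\sum_{n=2}^{\infty}a_nz^n$ in $\mathbb{D}$. Then $|T_3(2)|\le 84$. The inequality is sharp, i.e. there is a function in $\mathcal{S}^*$ for which equality holds.
   Context: $\mathbb{D}=\{z\in\mathbb{C}:|z|<1\}$. $\mathcal{A}$ is the class of analytic functions $f$ in $\mathbb{D}$ with Taylor series $f(z)=z+\sum_{n=2}^\infty a_nz^n$, and $\mathcal{S}$ is the subclass of univalent functions in $\mathcal{A}$. $\mathcal{S}^*$ is the class of starlike functions in $\mathcal{S}$, i.e. those for which $f(\mathbb{D})$ is starlike with respect to the origin; equivalently, $f\in\mathcal{A}$ and $\operatorname{Re}(zf'(z)/f(z))>0$ in $\mathbb{D}$. The symmetric Toeplitz determinant $T_3(2)$ of $f$ is $T_3(2)=\det\begin{pmatrix} a_2 & a_3 & a_4 \\ a_3 & a_2 & a_3 \\ a_4 & a_3 & a_2 \end{pmatrix}$. *)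

theory Defs
  imports "HOL-Complex_Analysis.Complex_Analysis"
begin

abbreviation unit_disc :: "complex set" where
  "unit_disc \<equiv> ball 0 1"

definition taylor_coeff :: "(complex \<Rightarrow> complex) \<Rightarrow> nat \<Rightarrow> complex" where
  "taylor_coeff f n = (deriv ^^ n) f 0 / fact n"

definition class_A :: "(complex \<Rightarrow> complex) set" where
  "class_A = {f. f holomorphic_on unit_disc \<and> taylor_coeff f 0 = 0 \<and> taylor_coeff f 1 = 1}"

definition class_S :: "(complex \<Rightarrow> complex) set" where
  "class_S = {f \<in> class_A. inj_on f unit_disc}"

text \<open>The library's \<^const>\<open>starlike\<close> only asks for some centre; here the centre is the origin.\<close>

definition starlike_wrt_origin :: "complex set \<Rightarrow> bool" where
  "starlike_wrt_origin D \<longleftrightarrow> (\<forall>w\<in>D. closed_segment 0 w \<subseteq> D)"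

definition class_S_star :: "(complex \<Rightarrow> complex) set" where
  "class_S_star = {f \<in> class_S. starlike_wrt_origin (f ` unit_disc)}"

definition toeplitz_3_2 :: "(complex \<Rightarrow> complex) \<Rightarrow> complex" where
  "toeplitz_3_2 f = (let a = taylor_coeff f in
     det (vector [vector [a 2, a 3, a 4],
                  vector [a 3, a 2, a 3],
                  vector [a 4, a 3, a 2]] :: complex^3^3))"

lemma class_A_expansion:
  assumes "f \<in> class_A" "z \<in> unit_disc"
  shows "(\<lambda>n. taylor_coeff f (n + 2) * z ^ (n + 2)) sums (f z - z)"
proof -
  have "(\<lambda>n. taylor_coeff f n * z ^ n) sums f z"
    using holomorphic_power_series[of f 0 1 z] assms
    by (simp add: class_A_def taylor_coeff_def)
  then have "(\<lambda>n. taylor_coeff f (n + 2) * z ^ (n + 2)) sums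
      (f z - (\<Sum>n<2. taylor_coeff f n * z ^ n))"
    by (rule sums_split_initial_segment)
  then show ?thesis
    using assms(1) by (simp add: class_A_def eval_nat_numeral)
qed

end

theory Submission imports Defs begin

text \<open>
  The determinant factors as \<open>(a\<^sub>2 - a\<^sub>4) (a\<^sub>2\<^sup>2 + a\<^sub>2 a\<^sub>4 - 2 a\<^sub>3\<^sup>2)\<close>. Applying the Schwarz lemma to
  \<open>z \<mapsto> f\<^sup>-\<^sup>1 (t f(z))\<close> and differentiating at \<open>t = 1\<close> shows that
  \<open>p(z) = z f'(z) / f(z) = 1 + c\<^sub>1 z + c\<^sub>2 z\<^sup>2 + \<dots>\<close> has nonnegative real part, which yields
  \<open>|c\<^sub>n| \<le> 2\<close> and \<open>|c\<^sub>3 - c\<^sub>1 c\<^sub>2| \<le> 2\<close>. Since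
  \<open>a\<^sub>2 a\<^sub>4 - 2 a\<^sub>3\<^sup>2 = c\<^sub>1 (c\<^sub>3 - c\<^sub>1 c\<^sub>2) / 3 - c\<^sub>1\<^sup>2 c\<^sub>2 / 6 - c\<^sub>2\<^sup>2 / 2 - c\<^sub>1\<^sup>4 / 3\<close>, the second factor
  is at most 14, while the first is at most 6. Both bounds are attained by
  the rotated Koebe function \<open>z / (1 - i z)\<^sup>2\<close>, for which \<open>a\<^sub>n = n i\<^sup>n\<^sup>-\<^sup>1\<close>.
\<close>

section \<open>Taylor coefficients as integrals over circles\<close>

text \<open>Estimates on the circle of radius \<open>r\<close> carry a factor \<open>r ^ n\<close>;
  letting \<open>r\<close> tend to 1 from the left removes it.\<close>

lemma bound_of_circle_bounds:
  fixes x B :: real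
  assumes "\<And>r. 0 < r \<Longrightarrow> r < 1 \<Longrightarrow> r ^ n * x \<le> B"
  shows "x \<le> B"
proof -
  have "((\<lambda>r::real. r ^ n * x) \<longlongrightarrow> 1 ^ n * x) (at_left 1)"
    by (intro tendsto_intros)
  moreover have "eventually (\<lambda>r::real. r ^ n * x \<le> B) (at_left 1)"
    using eventually_at_left_real[OF zero_less_one] by eventually_elim (auto intro: assms)
  ultimately show ?thesis
    using tendsto_upperbound[of _ _ "at_left (1::real)" B] by fastforce
qed

lemma has_integral_circlepath:
  assumes "(f has_contour_integral I) (circlepath 0 r)"
  shows "((\<lambda>t. f (of_real r * cis (2 * pi * t)) * (2 * pi * \<i> * r * cis (2 * pi * t)))
           has_integral I) {0..1}"
proof -
  have "circlepath 0 r t = of_real r * cis (2 * pi * t)" for t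
    by (simp add: circlepath cis_conv_exp mult_ac)
  moreover have "vector_derivative (circlepath 0 r) (at t within {0..1}) =
      2 * pi * \<i> * r * cis (2 * pi * t)" if "t \<in> {0..1}" for t
    using that by (simp add: vector_derivative_circlepath01 cis_conv_exp mult_ac)
  ultimately show ?thesis
    using assms unfolding has_contour_integral_def
    by (elim has_integral_eq[rotated]) simp
qed

text \<open>Cauchy's formula for the \<open>n\<close>-th derivative; on the unit circle inverse and
  conjugate agree, so the negative power becomes a power of \<open>cnj\<close>.\<close>

lemma has_integral_circle_taylor_coeff:
  assumes "p holomorphic_on ball 0 1" "0 < r" "r < 1"
  shows "((\<lambda>t. p (of_real r * cis (2 * pi * t)) * cnj (cis (2 * pi * t)) ^ n)
           has_integral taylor_coeff p n * of_real r ^ n) {0..1}"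
proof -
  have "((\<lambda>u. p u / (u - 0) ^ Suc n) has_contour_integral
          ((2 * pi * \<i>) / fact n * (deriv ^^ n) p 0)) (circlepath 0 r)"
    using assms
    by (intro Cauchy_has_contour_integral_higher_derivative_circlepath)
       (auto intro!: holomorphic_on_imp_continuous_on intro: holomorphic_on_subset)
  then have "((\<lambda>t. p (of_real r * cis (2 * pi * t)) / (of_real r * cis (2 * pi * t)) ^ Suc n *
          (2 * pi * \<i> * r * cis (2 * pi * t))) has_integral 2 * pi * \<i> * taylor_coeff p n) {0..1}"
    by (auto dest!: has_integral_circlepath simp: taylor_coeff_def)
  then have "((\<lambda>t. p (of_real r * cis (2 * pi * t)) / (of_real r * cis (2 * pi * t)) ^ Suc n *
          (2 * pi * \<i> * r * cis (2 * pi * t)) * (of_real r ^ n / (2 * pi * \<i>))) has_integral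
          2 * pi * \<i> * taylor_coeff p n * (of_real r ^ n / (2 * pi * \<i>))) {0..1}"
    by (rule has_integral_mult_left)
  then show ?thesis
    using assms(2)
    by (rule_tac has_integral_eq_rhs[OF has_integral_eq, rotated])
       (auto simp: power_mult_distrib cis_cnj cis_inverse[symmetric] power_inverse field_simps)
qed

text \<open>Cauchy's theorem for \<open>p u * u ^ (n - 1)\<close>; the line element supplies the
  missing factor.\<close>

lemma has_integral_circle_power_mult:
  assumes "p holomorphic_on ball 0 1" "0 < r" "r < 1" "0 < n"
  shows "((\<lambda>t. p (of_real r * cis (2 * pi * t)) * cis (2 * pi * t) ^ n) has_integral 0) {0..1}"
proof -
  have "((\<lambda>u. p u * u ^ (n - 1)) has_contour_integral 0) (circlepath 0 r)"
    using assms
    by (intro Cauchy_theorem_convex_simple[of _ "ball 0 1"] holomorphic_intros) auto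
  then have "((\<lambda>t. p (of_real r * cis (2 * pi * t)) * (of_real r * cis (2 * pi * t)) ^ (n - 1) *
          (2 * pi * \<i> * r * cis (2 * pi * t))) has_integral 0) {0..1}"
    by (rule has_integral_circlepath)
  from has_integral_mult_left[OF this, of "1 / (of_real r ^ n * (2 * pi * \<i>))"] show ?thesis
    unfolding mult_zero_left
  proof (rule has_integral_eq[rotated])
    fix t :: real
    obtain m where "n = Suc m" using assms(4) gr0_implies_Suc by blast
    then show "p (of_real r * cis (2 * pi * t)) * (of_real r * cis (2 * pi * t)) ^ (n - 1) *
        (2 * pi * \<i> * r * cis (2 * pi * t)) * (1 / (of_real r ^ n * (2 * pi * \<i>))) =
        p (of_real r * cis (2 * pi * t)) * cis (2 * pi * t) ^ n"
      using assms(2) by (simp add: power_mult_distrib)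
  qed
qed

text \<open>Adding the conjugate of the vanishing integral replaces \<open>p\<close> by
  \<open>p + cnj p\<close>, that is, by the real weight \<open>2 * Re p\<close>.\<close>

lemma has_integral_circle_Re:
  assumes "p holomorphic_on ball 0 1" "0 < r" "r < 1" "0 < n"
  shows "((\<lambda>t. of_real (2 * Re (p (of_real r * cis (2 * pi * t)))) * cnj (cis (2 * pi * t)) ^ n)
           has_integral taylor_coeff p n * of_real r ^ n) {0..1}"
proof -
  have "((\<lambda>t. cnj (p (of_real r * cis (2 * pi * t)) * cis (2 * pi * t) ^ n)) has_integral cnj 0) {0..1}"
    using has_integral_linear[OF has_integral_circle_power_mult[OF assms] bounded_linear_cnj]
    by (simp only: o_def)
  from has_integral_add[OF has_integral_circle_taylor_coeff[OF assms(1-3), of n] this]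
  show ?thesis
    unfolding complex_cnj_zero add_0_right
  proof (rule has_integral_eq[rotated])
    fix t :: real
    show "p (of_real r * cis (2 * pi * t)) * cnj (cis (2 * pi * t)) ^ n +
        cnj (p (of_real r * cis (2 * pi * t)) * cis (2 * pi * t) ^ n) =
        of_real (2 * Re (p (of_real r * cis (2 * pi * t)))) * cnj (cis (2 * pi * t)) ^ n"
      unfolding complex_cnj_mult complex_cnj_power complex_add_cnj[symmetric]
      by (rule distrib_right[symmetric])
  qed
qed

text \<open>For \<open>n = 0\<close> the conjugate integral does not vanish; the mean value property
  gives the total mass of the weight instead.\<close>

lemma has_integral_circle_Re_0:
  assumes "p holomorphic_on ball 0 1" "p 0 = 1" "0 < r" "r < 1"
  shows "((\<lambda>t. 2 * Re (p (of_real r * cis (2 * pi * t)))) has_integral 2) {0..1}"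
proof -
  have "((\<lambda>t. p (of_real r * cis (2 * pi * t))) has_integral 1) {0..1}"
    using has_integral_circle_taylor_coeff[OF assms(1,3,4), of 0] assms(2)
    by (simp add: taylor_coeff_def)
  from has_integral_mult_right[OF has_integral_Re[OF this], of 2] show ?thesis by simp
qed

lemma has_integral_norm_le:
  fixes f :: "real \<Rightarrow> complex"
  assumes "(f has_integral I) S" "(g has_integral J) S" "\<And>x. x \<in> S \<Longrightarrow> norm (f x) \<le> g x"
  shows "norm I \<le> J"
  using integral_norm_bound_integral[of f S g] assms
  by (auto simp: has_integral_iff)

text \<open>Powers of \<open>cis\<close> have modulus 1, so the integrand for the coefficient is
  dominated by the nonnegative weight \<open>2 * Re p\<close>, of mass 2.\<close>

theorem caratheodory_coeff_bound:
  assumes "p holomorphic_on ball 0 1" "p 0 = 1" "\<And>z. z \<in> ball 0 1 \<Longrightarrow> 0 \<le> Re (p z)" "0 < n"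
  shows "norm (taylor_coeff p n) \<le> 2"
proof (rule bound_of_circle_bounds[of n])
  fix r :: real assume r: "0 < r" "r < 1"
  have "norm (taylor_coeff p n * of_real r ^ n) \<le> 2"
    by (rule has_integral_norm_le[OF has_integral_circle_Re[OF assms(1) r assms(4)]
          has_integral_circle_Re_0[OF assms(1,2) r]])
       (use assms(3) r in \<open>auto simp: norm_mult norm_power\<close>)
  then show "r ^ n * norm (taylor_coeff p n) \<le> 2"
    using r by (simp add: norm_mult norm_power mult.commute)
qed

text \<open>With the probability density \<open>Re p\<close> on the circle of radius \<open>r\<close>, and with \<open>c\<^sub>n\<close> the
  coefficients of \<open>p(r z)\<close>, one has \<open>c\<^sub>n = 2 E(\<zeta>\<^sup>-\<^sup>n)\<close>, so that
  \<open>c\<^sub>m\<^sub>+\<^sub>n - c\<^sub>m c\<^sub>n = 2 E(\<zeta>\<^sup>-\<^sup>m (\<zeta>\<^sup>-\<^sup>n - c\<^sub>n))\<close>; the bound follows from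
  \<open>2 |\<zeta>\<^sup>-\<^sup>n - c\<^sub>n| \<le> 1 + |\<zeta>\<^sup>-\<^sup>n - c\<^sub>n|\<^sup>2\<close>, whose right-hand side has expectation 2.\<close>

theorem livingston_coeff_bound:
  assumes hol: "p holomorphic_on ball 0 1" and p0: "p 0 = 1"
    and pos: "\<And>z. z \<in> ball 0 1 \<Longrightarrow> 0 \<le> Re (p z)" and mn: "0 < m" "0 < n"
  shows "norm (taylor_coeff p (m + n) - taylor_coeff p m * taylor_coeff p n) \<le> 2"
proof (rule bound_of_circle_bounds[of "m + n"])
  fix r :: real assume r: "0 < r" "r < 1"
  define d where "d k = taylor_coeff p k * of_real r ^ k" for k
  define z where "z t = cnj (cis (2 * pi * t))" for t
  define u where "u t = 2 * Re (p (of_real r * cis (2 * pi * t)))" for t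
  have u: "0 \<le> u t" for t
    using pos r by (auto simp: u_def norm_mult)
  have I: "((\<lambda>t. of_real (u t) * z t ^ k) has_integral d k) {0..1}" if "0 < k" for k
    unfolding u_def z_def d_def using has_integral_circle_Re[OF hol r that] .
  have I0: "(u has_integral 2) {0..1}"
    unfolding u_def using has_integral_circle_Re_0[OF hol p0 r] .
  have "((\<lambda>t. of_real (u t) * z t ^ (m + n) - of_real (u t) * z t ^ m * d n)
          has_integral d (m + n) - d m * d n) {0..1}"
    using mn by (intro has_integral_diff has_integral_mult_left I) auto
  \<comment> \<open>The majorant is \<open>u t * (1 + (norm (z t ^ n - d n))\<^sup>2) / 2\<close>
    with the square expanded, so that only the mass of \<open>u\<close> and \<open>d n\<close> enter
    its integral.\<close>
  moreover have "((\<lambda>t. u t * ((2 + (norm (d n))\<^sup>2) / 2) - Re (of_real (u t) * z t ^ n * cnj (d n)))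
          has_integral 2 * ((2 + (norm (d n))\<^sup>2) / 2) - Re (d n * cnj (d n))) {0..1}"
    using mn by (intro has_integral_diff has_integral_mult_left has_integral_Re I I0) auto
  moreover have "norm (of_real (u t) * z t ^ (m + n) - of_real (u t) * z t ^ m * d n)
      \<le> u t * ((2 + (norm (d n))\<^sup>2) / 2) - Re (of_real (u t) * z t ^ n * cnj (d n))" for t
  proof -
    have nz: "norm (z t ^ k) = 1" for k by (simp add: z_def norm_power)
    have "norm (of_real (u t) * z t ^ (m + n) - of_real (u t) * z t ^ m * d n)
        = norm (of_real (u t) * z t ^ m * (z t ^ n - d n))"
      by (simp add: algebra_simps power_add)
    also have "\<dots> = u t * norm (z t ^ n - d n)"
      using u[of t] nz[of m] by (simp add: norm_mult)
    also have "\<dots> \<le> u t * ((1 + (norm (z t ^ n - d n))\<^sup>2) / 2)"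
      using u[of t] sum_squares_bound[of 1 "norm (z t ^ n - d n)"]
      by (intro mult_left_mono) auto
    also have "(norm (z t ^ n - d n))\<^sup>2 = 1 + (norm (d n))\<^sup>2 - 2 * Re (z t ^ n * cnj (d n))"
    proof -
      have "(Re (z t ^ n))\<^sup>2 + (Im (z t ^ n))\<^sup>2 = 1"
        using nz[of n] cmod_power2[of "z t ^ n"] by simp
      then show ?thesis
        unfolding cmod_power2 by (simp add: power2_eq_square algebra_simps)
    qed
    also have "u t * ((1 + (1 + (norm (d n))\<^sup>2 - 2 * Re (z t ^ n * cnj (d n)))) / 2)
       = u t * ((2 + (norm (d n))\<^sup>2) / 2) - Re (of_real (u t) * z t ^ n * cnj (d n))"
      by (simp add: field_simps)
    finally show ?thesis .
  qed
  ultimately have "norm (d (m + n) - d m * d n)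
      \<le> 2 * ((2 + (norm (d n))\<^sup>2) / 2) - Re (d n * cnj (d n))"
    by (rule has_integral_norm_le)
  also have "\<dots> = 2"
    by (simp add: complex_mult_cnj cmod_power2 field_simps)
  also have "d (m + n) - d m * d n =
      of_real r ^ (m + n) * (taylor_coeff p (m + n) - taylor_coeff p m * taylor_coeff p n)"
    by (simp add: d_def power_add algebra_simps)
  finally show "r ^ (m + n) * norm (taylor_coeff p (m + n) - taylor_coeff p m * taylor_coeff p n) \<le> 2"
    using r by (simp add: norm_mult norm_power)
qed

section \<open>Formal power series and the factored determinant\<close>

lemma taylor_coeff_fps:
  assumes "f has_fps_expansion F"
  shows "taylor_coeff f n = fps_nth F n"
  using fps_nth_fps_expansion[OF assms] by (simp add: taylor_coeff_def)

lemma fps_expansion_eq_if_eventually_eq: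
  fixes f g :: "complex \<Rightarrow> complex"
  assumes "f has_fps_expansion F" "g has_fps_expansion G" "eventually (\<lambda>z. f z = g z) (nhds 0)"
  shows "F = G"
  using assms(1,2) has_fps_expansion_cong[OF assms(3) refl, of F]
  by (intro fps_expansion_unique_complex[of g]) auto

text \<open>The vector (1, 0, -1) is an eigenvector with eigenvalue a2 - a4; the other factor is the
  determinant on the symmetric vectors (x, y, x).\<close>

lemma toeplitz_3_2_eq:
  "toeplitz_3_2 f = (taylor_coeff f 2 - taylor_coeff f 4) *
    ((taylor_coeff f 2)\<^sup>2 + taylor_coeff f 2 * taylor_coeff f 4 - 2 * (taylor_coeff f 3)\<^sup>2)"
  by (simp add: toeplitz_3_2_def Let_def det_3 vector_3 power2_eq_square algebra_simps)

section \<open>From starlikeness to coefficient relations\<close>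

lemma starlike_log_derivative:
  assumes "f \<in> class_S_star"
  obtains p where "p holomorphic_on unit_disc" "p 0 = 1"
    "\<And>z. z \<in> unit_disc \<Longrightarrow> 0 \<le> Re (p z)"
    "\<And>z. z \<in> unit_disc \<Longrightarrow> z * deriv f z = p z * f z"
proof -
  have hol: "f holomorphic_on unit_disc" and f0: "f 0 = 0" and f'0: "deriv f 0 = 1"
    and inj: "inj_on f unit_disc" and star: "\<And>w. w \<in> f ` unit_disc \<Longrightarrow> closed_segment 0 w \<subseteq> f ` unit_disc"
    using assms by (auto simp: class_S_star_def class_S_def class_A_def taylor_coeff_def starlike_wrt_origin_def)
  obtain g where g: "g holomorphic_on f ` unit_disc"
    "\<And>z. z \<in> unit_disc \<Longrightarrow> deriv f z * deriv g (f z) = 1" "\<And>z. z \<in> unit_disc \<Longrightarrow> g (f z) = z"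
    using holomorphic_has_inverse[OF hol open_ball inj] by blast
  have opn: "open (f ` unit_disc)"
    using open_mapping_thm3[OF hol open_ball inj] .
  \<comment> \<open>The quotient f(z)/z with its singularity at 0 removed; \<open>p\<close> will be
    \<open>deriv f z / q z\<close>, which is thus holomorphic at 0 too.\<close>
  define q where "q z = (if z = 0 then deriv f 0 else (f z - f 0) / (z - 0))" for z
  have holq: "q holomorphic_on unit_disc"
    unfolding q_def using pole_lemma_open[OF hol open_ball] .
  have fz: "f z \<noteq> 0" if "z \<in> unit_disc" "z \<noteq> 0" for z
    using inj_onD[OF inj, of z 0] that f0 by auto
  have q: "q z \<noteq> 0" if "z \<in> unit_disc" for z
    using that fz f0 f'0 by (auto simp: q_def)
  \<comment> \<open>Half the derivative at t = 1 of the squared modulus of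
    \<open>g (t * f z)\<close>. For z \<noteq> 0 it is the real part of
    \<open>(norm z)\<^sup>2 / p z\<close>.\<close>
  have key: "0 \<le> Re (cnj z * f z / deriv f z)" if z: "z \<in> unit_disc" for z
  proof (rule ccontr)
    assume neg: "\<not> ?thesis"
    \<comment> \<open>Starlikeness enters here: the inverse \<open>g\<close> is defined on the whole
      segment from 0 to \<open>f x\<close>.\<close>
    have tin: "of_real t * f x \<in> f ` unit_disc" if "x \<in> unit_disc" "0 \<le> t" "t \<le> 1" for x t
      using star[of "f x"] that by (force simp: closed_segment_def scaleR_conv_of_real)
    have gdisc: "g w \<in> unit_disc" if "w \<in> f ` unit_disc" for w
      using that g(3) by auto
    have schwarz: "norm (g (of_real t * f z)) \<le> norm z" if t: "0 \<le> t" "t \<le> 1" for t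
    proof (rule Schwarz_Lemma(1)[of "\<lambda>x. g (of_real t * f x)"])
      show "(\<lambda>x. g (of_real t * f x)) holomorphic_on ball 0 1"
        using tin t
        by (intro holomorphic_on_compose_gen[OF _ g(1), unfolded o_def] holomorphic_intros hol) auto
      show "norm (g (of_real t * f x)) < 1" if "norm x < 1" for x
        using gdisc[OF tin[OF _ t]] that by auto
      show "g (of_real t * f 0) = 0" using g(3)[of 0] f0 by simp
    qed (use z in auto)
    define h where "h t = (norm (g (of_real t * f z)))\<^sup>2" for t
    have dg: "(g has_field_derivative 1 / deriv f z) (at (f z))"
    proof -
      have "(g has_field_derivative deriv g (f z)) (at (f z))"
        using holomorphic_derivI[OF g(1) opn] z by auto
      moreover have "deriv g (f z) = 1 / deriv f z"
        using g(2)[OF z] by (metis mult_eq_0_iff nonzero_eq_divide_eq mult.commute zero_neq_one)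
      ultimately show ?thesis by simp
    qed
    define v where "v = f z * (1 / deriv f z)"
    have v: "cnj z * f z / deriv f z = cnj z * v" by (simp add: v_def)
    have dG: "((\<lambda>t. g (of_real t * f z)) has_vector_derivative v) (at 1)"
      unfolding v_def
      by (rule field_vector_diff_chain_at[unfolded o_def])
         (use dg in \<open>auto intro!: derivative_eq_intros simp: has_vector_derivative_def scaleR_conv_of_real\<close>)
    have "((\<lambda>t. g (of_real t * f z) \<bullet> g (of_real t * f z)) has_vector_derivative
        2 * Re (cnj z * f z / deriv f z)) (at 1)"
      using bounded_bilinear.has_vector_derivative[OF bounded_bilinear_inner dG dG] g(3)[OF z]
      by (simp add: v inner_complex_def algebra_simps)
    then have "(h has_real_derivative 2 * Re (cnj z * f z / deriv f z)) (at 1)"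
      by (simp add: h_def[abs_def] has_real_derivative_iff_has_vector_derivative power2_norm_eq_inner)
    \<comment> \<open>A negative derivative would make \<open>h\<close> exceed
      \<open>h 1 = (norm z)\<^sup>2\<close> just left of 1, against the Schwarz bound.\<close>
    from DERIV_neg_dec_left[OF this] neg obtain d where d: "0 < d"
      "\<And>k. 0 < k \<Longrightarrow> k < d \<Longrightarrow> h 1 < h (1 - k)" by auto
    define k where "k = min (d / 2) (1 / 2)"
    have "h 1 < h (1 - k)" using d by (intro d) (auto simp: k_def)
    moreover have "h (1 - k) \<le> h 1"
      using schwarz[of "1 - k"] d(1) g(3)[OF z] by (auto simp: h_def k_def intro!: power_mono)
    ultimately show False by simp
  qed
  show ?thesis
  proof (rule that[of "\<lambda>z. deriv f z / q z"])
    show "(\<lambda>z. deriv f z / q z) holomorphic_on unit_disc"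
      by (intro holomorphic_intros holq holomorphic_deriv[OF hol]) (use q in auto)
    show "deriv f 0 / q 0 = 1" by (simp add: q_def f'0)
    show "z * deriv f z = deriv f z / q z * f z" if "z \<in> unit_disc" for z
      using that fz[of z] f0 f'0 by (auto simp: q_def)
    show "0 \<le> Re (deriv f z / q z)" if z: "z \<in> unit_disc" for z
    proof (cases "z = 0")
      case False
      define w where "w = cnj z * f z / deriv f z"
      have "deriv f z \<noteq> 0" using g(2)[OF z] by auto
      then have w0: "w \<noteq> 0" using fz[OF z False] False by (simp add: w_def)
      \<comment> \<open>Inversion preserves the sign of the real part, so \<open>key\<close> carries
        over to \<open>p\<close>.\<close>
      have "deriv f z / q z = of_real ((norm z)\<^sup>2) * inverse w"
        using False f0 unfolding complex_norm_square by (simp add: q_def w_def field_simps)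
      also have "Re \<dots> = (norm z)\<^sup>2 * (Re w / (norm w)\<^sup>2)"
        by (simp add: cmod_power2)
      also have "\<dots> \<ge> 0" using key[OF z] by (simp add: w_def)
      finally show ?thesis .
    qed (simp add: q_def f'0)
  qed
qed

text \<open>Comparing coefficients in z f'(z) = p(z) f(z) determines the coefficients of f
  recursively; denominators are cleared.\<close>

lemma starlike_coeffs:
  assumes f: "f \<in> class_S_star" and p: "p holomorphic_on unit_disc" "p 0 = 1"
    and eq: "\<And>z. z \<in> unit_disc \<Longrightarrow> z * deriv f z = p z * f z"
  shows "taylor_coeff f 2 = taylor_coeff p 1"
    "2 * taylor_coeff f 3 = taylor_coeff p 2 + (taylor_coeff p 1)\<^sup>2"
    "6 * taylor_coeff f 4 = 2 * taylor_coeff p 3 + 3 * taylor_coeff p 1 * taylor_coeff p 2 + taylor_coeff p 1 ^ 3"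
proof -
  have hol: "f holomorphic_on unit_disc" and c: "taylor_coeff f 0 = 0" "taylor_coeff f 1 = 1"
    using f by (auto simp: class_S_star_def class_S_def class_A_def)
  define F P where "F = fps_expansion f 0" and "P = fps_expansion p 0"
  have F: "f has_fps_expansion F" and P: "p has_fps_expansion P"
    unfolding F_def P_def using hol p(1) by (auto intro!: has_fps_expansion_fps_expansion[of unit_disc])
  have "eventually (\<lambda>z::complex. z \<in> unit_disc) (nhds 0)"
    by (intro eventually_nhds_in_open) auto
  then have "eventually (\<lambda>z. z * deriv f z = p z * f z) (nhds 0)"
    by eventually_elim (rule eq)
  then have PF: "fps_X * fps_deriv F = P * F"
    by (rule fps_expansion_eq_if_eventually_eq[rotated 2]) (intro fps_expansion_intros F P)+
  note tF = taylor_coeff_fps[OF F] and tP = taylor_coeff_fps[OF P]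
  have 0: "fps_nth F 0 = 0" "fps_nth F (Suc 0) = 1" "fps_nth P 0 = 1"
    using c p(2) tF[of 0] tF[of 1] tP[of 0] by (auto simp: taylor_coeff_def)
  \<comment> \<open>The term i = 0 is \<open>fps_nth F n\<close> itself and the term i = n vanishes,
    so this computes (n - 1) times the coefficient for n \<ge> 1.\<close>
  have eq: "of_nat n * fps_nth F n = (\<Sum>i=0..n. fps_nth P i * fps_nth F (n - i))" for n
  proof -
    have "of_nat n * fps_nth F n = fps_nth (fps_X * fps_deriv F) n"
      by (cases n) auto
    then show ?thesis by (simp only: PF fps_mult_nth)
  qed
  have e2: "fps_nth F 2 = fps_nth P 1"
    using eq[of 2] 0 by (simp add: eval_nat_numeral)
  have e3: "2 * fps_nth F 3 = fps_nth P 2 + (fps_nth P 1)\<^sup>2"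
    using eq[of 3] 0 e2 by (simp add: eval_nat_numeral)
  have e4: "6 * fps_nth F 4 = 2 * fps_nth P 3 + 3 * fps_nth P 1 * fps_nth P 2 + fps_nth P 1 ^ 3"
  proof -
    have "3 * fps_nth F 4 = fps_nth P 3 + fps_nth P 2 * fps_nth F 2 + fps_nth P 1 * fps_nth F 3"
      using eq[of 4] 0 by (simp add: eval_nat_numeral algebra_simps)
    moreover have "fps_nth F 3 = (fps_nth P 2 + (fps_nth P 1)\<^sup>2) / 2"
      using e3 by (simp add: eq_divide_eq mult.commute)
    ultimately have "2 * (3 * fps_nth F 4) = 2 * (fps_nth P 3 + fps_nth P 2 * fps_nth P 1 +
        fps_nth P 1 * ((fps_nth P 2 + (fps_nth P 1)\<^sup>2) / 2))"
      using e2 by (simp only:)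
    then show ?thesis by (simp add: algebra_simps power2_eq_square power3_eq_cube)
  qed
  show "taylor_coeff f 2 = taylor_coeff p 1"
    "2 * taylor_coeff f 3 = taylor_coeff p 2 + (taylor_coeff p 1)\<^sup>2"
    "6 * taylor_coeff f 4 = 2 * taylor_coeff p 3 + 3 * taylor_coeff p 1 * taylor_coeff p 2 + taylor_coeff p 1 ^ 3"
    using e2 e3 e4 by (simp_all add: tF tP)
qed

section \<open>The upper bound\<close>

lemma toeplitz_3_2_le:
  assumes "f \<in> class_S_star"
  shows "norm (toeplitz_3_2 f) \<le> 84"
proof -
  obtain p where p: "p holomorphic_on unit_disc" "p 0 = 1"
    "\<And>z. z \<in> unit_disc \<Longrightarrow> 0 \<le> Re (p z)"
    "\<And>z. z \<in> unit_disc \<Longrightarrow> z * deriv f z = p z * f z"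
    using starlike_log_derivative[OF assms] by blast
  define a c where "a = taylor_coeff f" and "c = taylor_coeff p"
  have c: "norm (c n) \<le> 2" if "0 < n" for n
    using caratheodory_coeff_bound[OF p(1-3) that] by (simp add: c_def)
  have liv: "norm (c 3 - c 1 * c 2) \<le> 2"
    using livingston_coeff_bound[OF p(1-3), of 1 2] by (simp add: c_def numeral_3_eq_3)
  have a: "a 2 = c 1" "2 * a 3 = c 2 + (c 1)\<^sup>2" "6 * a 4 = 2 * c 3 + 3 * c 1 * c 2 + c 1 ^ 3"
    unfolding a_def c_def using starlike_coeffs[OF assms p(1,2)] p(4) by blast+
  have pw: "norm (c 1) ^ k \<le> 2 ^ k" "norm (c 2) ^ k \<le> 2 ^ k" for k
    using c[of 1] c[of 2] by (auto intro: power_mono)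
  have m: "norm x \<le> A \<Longrightarrow> norm y \<le> B \<Longrightarrow> norm (x * y) \<le> A * B" for x y :: complex and A B
    by (simp add: norm_mult mult_mono')
  \<comment> \<open>The four terms contribute 12 + 4 + 12 + 8.\<close>
  have "norm (6 * (a 2 - a 4)) \<le> 36"
  proof -
    have "6 * (a 2 - a 4) = 6 * c 1 - 2 * c 3 - 3 * (c 1 * c 2) - c 1 ^ 3"
      using a by (simp add: algebra_simps)
    also have "norm \<dots> \<le> norm (6 * c 1) + norm (2 * c 3) + norm (3 * (c 1 * c 2)) + norm (c 1 ^ 3)"
      by (intro order.trans[OF norm_triangle_ineq4] add_mono order.refl)
    also have "\<dots> \<le> 36"
      using c[of 1] c[of 3] m[OF c[of 1] c[of 2]] pw(1)[of 3] by (simp add: norm_mult norm_power)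
    finally show ?thesis .
  qed
  then have 1: "norm (a 2 - a 4) \<le> 6" unfolding norm_mult by simp
  have "norm (6 * ((a 2)\<^sup>2 + a 2 * a 4 - 2 * (a 3)\<^sup>2)) \<le> 84"
  proof -
    \<comment> \<open>Pairing \<open>c 3\<close> with \<open>c 1 * c 2\<close> lets
      \<open>liv\<close> apply: the terms give 24 + 8 + 8 + 12 + 32 = 84, whereas the fully expanded
      form would only give 100.\<close>
    have eq: "6 * ((a 2)\<^sup>2 + a 2 * a 4 - 2 * (a 3)\<^sup>2) =
        6 * (c 1)\<^sup>2 + 2 * (c 1 * (c 3 - c 1 * c 2)) - (c 1)\<^sup>2 * c 2 - 3 * (c 2)\<^sup>2 - 2 * c 1 ^ 4"
    proof -
      have "a 3 = (c 2 + (c 1)\<^sup>2) / 2" "a 4 = (2 * c 3 + 3 * c 1 * c 2 + c 1 ^ 3) / 6"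
        using a(2,3) by (simp_all only: eq_divide_eq) (simp_all add: mult.commute)
      then show ?thesis
        by (simp only: a(1)) (simp add: field_simps eval_nat_numeral)
    qed
    have "norm (6 * ((a 2)\<^sup>2 + a 2 * a 4 - 2 * (a 3)\<^sup>2)) \<le> norm (6 * (c 1)\<^sup>2) + norm (2 * (c 1 * (c 3 - c 1 * c 2))) +
        norm ((c 1)\<^sup>2 * c 2) + norm (3 * (c 2)\<^sup>2) + norm (2 * c 1 ^ 4)"
      unfolding eq
      by (intro order.trans[OF norm_triangle_ineq4] order.trans[OF norm_triangle_ineq] add_mono order.refl)
    also have "\<dots> \<le> 84"
    proof -
      have q: "norm ((c 1)\<^sup>2) \<le> 4" "norm ((c 2)\<^sup>2) \<le> 4" "norm (c 1 ^ 4) \<le> 16"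
        using pw(1)[of 2] pw(1)[of 4] pw(2)[of 2] unfolding norm_power by simp_all
      have "norm (c 1 * (c 3 - c 1 * c 2)) \<le> 4" "norm ((c 1)\<^sup>2 * c 2) \<le> 8"
        using m[OF c[of 1] liv] m[OF q(1) c[of 2]] by simp_all
      moreover have n: "norm (6 * x) = 6 * norm x" "norm (3 * x) = 3 * norm x" "norm (2 * x) = 2 * norm x"
        for x :: complex by (simp_all only: norm_mult norm_numeral)
      ultimately show ?thesis using q unfolding n by linarith
    qed
    finally show ?thesis .
  qed
  then have 2: "norm ((a 2)\<^sup>2 + a 2 * a 4 - 2 * (a 3)\<^sup>2) \<le> 14" unfolding norm_mult by simp
  show ?thesis
    using m[OF 1 2] by (simp add: toeplitz_3_2_eq a_def)
qed

section \<open>The extremal function\<close>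

text \<open>The quarter turn aligns a2 with -a4, and a2 squared with a2 a4 - 2 a3^2, so nothing
  cancels in either factor of the determinant.\<close>

definition rotated_koebe :: "complex \<Rightarrow> complex" where
  "rotated_koebe z = z / (1 - \<i> * z)\<^sup>2"

lemma rotated_koebe_denom: "z \<in> unit_disc \<Longrightarrow> 1 - \<i> * z \<noteq> 0"
proof
  assume "z \<in> unit_disc" "1 - \<i> * z = 0"
  moreover have "norm z = norm (\<i> * z)" by (simp add: norm_mult)
  ultimately show False by simp
qed

lemma rotated_koebe_holomorphic: "rotated_koebe holomorphic_on unit_disc"
  unfolding rotated_koebe_def
  by (intro holomorphic_intros) (use rotated_koebe_denom in auto)

text \<open>Multiplying by the denominator \<open>1 - 2 * \<i> * z - z\<^sup>2\<close> gives the
  recurrence a(n) = 2i a(n-1) + a(n-2) for n \<ge> 2.\<close>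

lemma rotated_koebe_coeffs:
  "taylor_coeff rotated_koebe 0 = 0" "taylor_coeff rotated_koebe 1 = 1"
  "taylor_coeff rotated_koebe 2 = 2 * \<i>" "taylor_coeff rotated_koebe 3 = - 3"
  "taylor_coeff rotated_koebe 4 = - 4 * \<i>"
proof -
  define F where "F = fps_expansion rotated_koebe 0"
  have F: "rotated_koebe has_fps_expansion F"
    unfolding F_def using rotated_koebe_holomorphic
    by (auto intro!: has_fps_expansion_fps_expansion[of unit_disc])
  have "eventually (\<lambda>z::complex. z \<in> unit_disc) (nhds 0)"
    by (intro eventually_nhds_in_open) auto
  then have "eventually (\<lambda>z. rotated_koebe z - 2 * \<i> * (z * rotated_koebe z) - z * (z * rotated_koebe z) = z) (nhds 0)"
  proof eventually_elim
    case (elim z)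
    have "rotated_koebe z - 2 * \<i> * (z * rotated_koebe z) - z * (z * rotated_koebe z)
        = rotated_koebe z * (1 - \<i> * z)\<^sup>2"
      by (simp add: power2_eq_square algebra_simps)
    then show ?case using rotated_koebe_denom[OF elim] by (simp add: rotated_koebe_def)
  qed
  then have "F - fps_const (2 * \<i>) * (fps_X * F) - fps_X * (fps_X * F) = fps_X"
    by (rule fps_expansion_eq_if_eventually_eq[rotated 2]) (intro fps_expansion_intros F)+
  then have eq: "fps_nth (F - fps_const (2 * \<i>) * (fps_X * F) - fps_X * (fps_X * F)) n = fps_nth fps_X n" for n
    by simp
  have e0: "fps_nth F 0 = 0" using eq[of 0] by simp
  have e1: "fps_nth F 1 = 1" using eq[of 1] e0 by simp
  have e2: "fps_nth F 2 = 2 * \<i>" using eq[of 2] e0 e1 by simp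
  have e3: "fps_nth F 3 = -3" using eq[of 3] e1 e2 by (simp add: add_eq_0_iff)
  have e4: "fps_nth F 4 = - 4 * \<i>" using eq[of 4] e2 e3 by (simp add: add_eq_0_iff)
  show "taylor_coeff rotated_koebe 0 = 0" "taylor_coeff rotated_koebe 1 = 1"
    "taylor_coeff rotated_koebe 2 = 2 * \<i>" "taylor_coeff rotated_koebe 3 = - 3"
    "taylor_coeff rotated_koebe 4 = - 4 * \<i>"
    using e0 e1 e2 e3 e4 by (simp_all only: taylor_coeff_fps[OF F])
qed

lemma inj_on_rotated_koebe: "inj_on rotated_koebe unit_disc"
proof (rule inj_onI)
  fix z w assume zw: "z \<in> unit_disc" "w \<in> unit_disc" "rotated_koebe z = rotated_koebe w"
  then have "z * (1 - \<i> * w)\<^sup>2 = w * (1 - \<i> * z)\<^sup>2"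
    using rotated_koebe_denom[of z] rotated_koebe_denom[of w]
    by (simp add: rotated_koebe_def field_simps)
  then have "(z - w) * (1 + z * w) = 0"
    by (simp add: power2_eq_square algebra_simps)
  moreover have "norm (z * w) < 1"
    using mult_strict_mono'[of "norm z" 1 "norm w" 1] zw by (simp add: norm_mult)
  then have "1 + z * w \<noteq> 0"
    using arg_cong[of "z * w" "- 1" norm] by (auto simp: add_eq_0_iff)
  ultimately show "z = w" by simp
qed

text \<open>The Cayley transform turns \<open>1 + 4 i f(z)\<close> into the square of a number in the right half-plane.\<close>

lemma rotated_koebe_image:
  "rotated_koebe ` unit_disc = {w. 1 + 4 * \<i> * w \<notin> \<real>\<^sub>\<le>\<^sub>0}"
proof (intro equalityI subsetI)
  fix w assume "w \<in> rotated_koebe ` unit_disc"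
  then obtain z where z: "z \<in> unit_disc" "w = rotated_koebe z" by auto
  define m where "m = (1 + \<i> * z) / (1 - \<i> * z)"
  have m2: "1 + 4 * \<i> * w = m\<^sup>2"
  proof -
    have "m\<^sup>2 = (4 * \<i> * z + (1 - \<i> * z)\<^sup>2) / (1 - \<i> * z)\<^sup>2"
      by (simp add: m_def power_divide power2_eq_square algebra_simps)
    then show ?thesis
      using rotated_koebe_denom[OF z(1)] by (simp add: z(2) rotated_koebe_def add_divide_distrib)
  qed
  have "0 < Re m"
    using Re_complex_div_lemma[of "- z"] z(1) by (simp add: m_def)
  then have "m\<^sup>2 \<notin> \<real>\<^sub>\<le>\<^sub>0"
    by (auto simp: complex_nonpos_Reals_iff power2_eq_square not_le)
  then show "w \<in> {w. 1 + 4 * \<i> * w \<notin> \<real>\<^sub>\<le>\<^sub>0}" by (simp add: m2)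
next
  fix w assume "w \<in> {w. 1 + 4 * \<i> * w \<notin> \<real>\<^sub>\<le>\<^sub>0}"
  then have w: "1 + 4 * \<i> * w \<notin> \<real>\<^sub>\<le>\<^sub>0" by simp
  define s where "s = csqrt (1 + 4 * \<i> * w)"
  have s2: "s\<^sup>2 = 1 + 4 * \<i> * w" by (simp add: s_def)
  have "Re s \<noteq> 0"
    using w unfolding s2[symmetric] by (auto simp: complex_nonpos_Reals_iff power2_eq_square)
  then have s: "0 < Re s" using Re_csqrt[of "1 + 4 * \<i> * w"] by (simp add: s_def)
  have s1: "s + 1 \<noteq> 0" using s by (auto simp: complex_eq_iff)
  \<comment> \<open>Solves \<open>(1 + \<i> * z) / (1 - \<i> * z) = s\<close> for
    \<open>z\<close>.\<close>
  define z where "z = - \<i> * ((s - 1) / (s + 1))"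
  have "(norm (s - 1))\<^sup>2 < (norm (s + 1))\<^sup>2"
    unfolding cmod_power2 using s by (simp add: power2_eq_square algebra_simps)
  then have "norm (s - 1) < norm (s + 1)" by (rule power2_less_imp_less) simp
  then have "z \<in> unit_disc" using s1 by (simp add: z_def norm_mult norm_divide)
  moreover have "1 - \<i> * z = 2 / (s + 1)" using s1 by (simp add: z_def field_simps)
  then have "rotated_koebe z = w"
  proof -
    assume z1: "1 - \<i> * z = 2 / (s + 1)"
    have "rotated_koebe z = - \<i> * ((s - 1) * (s + 1)) / 4"
    proof -
      have "rotated_koebe z = - \<i> * ((s - 1) / x) / (2 / x)\<^sup>2" if "x = s + 1" for x
        using z1 that by (simp add: rotated_koebe_def z_def)
      moreover have "- \<i> * ((s - 1) / x) / (2 / x)\<^sup>2 = - \<i> * ((s - 1) * x) / 4" if "x \<noteq> 0" for x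
        using that by (simp add: field_simps power2_eq_square)
      ultimately show ?thesis using s1 by metis
    qed
    also have "(s - 1) * (s + 1) = s\<^sup>2 - 1" by (simp add: power2_eq_square algebra_simps)
    finally show ?thesis by (simp add: s2)
  qed
  ultimately show "w \<in> rotated_koebe ` unit_disc" by auto
qed

text \<open>The image omits exactly the ray from i/4 upwards along the imaginary axis. If t w lies
  on it with 0 < t \<le> 1, then so does w.\<close>

lemma rotated_koebe_starlike: "rotated_koebe \<in> class_S_star"
proof -
  have "starlike_wrt_origin (rotated_koebe ` unit_disc)"
    unfolding starlike_wrt_origin_def rotated_koebe_image
  proof (intro ballI subsetI)
    fix w v assume w: "w \<in> {w. 1 + 4 * \<i> * w \<notin> \<real>\<^sub>\<le>\<^sub>0}" and "v \<in> closed_segment 0 w"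
    then obtain t where t: "0 \<le> t" "t \<le> 1" "v = of_real t * w"
      by (auto simp: closed_segment_def scaleR_conv_of_real)
    show "v \<in> {w. 1 + 4 * \<i> * w \<notin> \<real>\<^sub>\<le>\<^sub>0}"
    proof (rule ccontr)
      assume "\<not> ?thesis"
      then have v: "1 \<le> 4 * (t * Im w)" "t * Re w = 0"
        by (auto simp: complex_nonpos_Reals_iff t(3))
      then have "0 < t * Im w" by linarith
      then have "0 < t" "0 < Im w" using t(1) by (auto simp: zero_less_mult_iff)
      then have "t * Im w \<le> Im w" using t(2) by (simp add: mult_left_le_one_le)
      then show False
        using w v \<open>0 < t\<close> by (auto simp: complex_nonpos_Reals_iff)
    qed
  qed
  then show ?thesis
    using rotated_koebe_holomorphic rotated_koebe_coeffs inj_on_rotated_koebe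
    by (simp add: class_S_star_def class_S_def class_A_def)
qed

theorem theorem2p2:
  "(\<forall>f \<in> class_S_star. norm (toeplitz_3_2 f) \<le> 84) \<and>
   (\<exists>f \<in> class_S_star. norm (toeplitz_3_2 f) = 84)"
proof
  \<comment> \<open>The two factors are 6i and -14.\<close>
  have "toeplitz_3_2 rotated_koebe = - 84 * \<i>"
    by (simp add: toeplitz_3_2_eq rotated_koebe_coeffs power2_eq_square)
  then show "\<exists>f \<in> class_S_star. norm (toeplitz_3_2 f) = 84"
    using rotated_koebe_starlike by (intro bexI[of _ rotated_koebe]) (auto simp: norm_mult)
qed (simp add: toeplitz_3_2_le)

end
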